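(* $\mathcal{L}(\mathsf{DFAwtw})\subsetneq\mathcal{L}(\mathsf{RDFAwtw})$ and $\mathcal{L}(\mathsf{NFAwtw})\subsetneq\mathcal{L}(\mathsf{RNFAwtw})$. That is, the class of languages accepted by non-repetitive deterministic finite automata with translucent words is properly contained in the class of languages accepted by repetitive ones, and likewise for nondeterministic finite automata with translucent words.
   Context: **Automata.** A repetitive finite automaton with translucent words (RNFAwtw) is a tuple $A=(Q,\Sigma,\lhd,\tau,I,\delta)$, where $Q$ is a finite set of states, $\Sigma$ is a finite input alphabet, $\lhd\notin\Sigma$ is an end-of-tape marker, $I\subseteq Q$ is the set of initial states, $\tau$ maps each state to a finite subset of $\Sigma^*$ (its translucent words), and $\delta$ is a transition function with $\delta(q,a)\subseteq Q$ for $q\in Q$, $a\in\Sigma$, and with $\delta(q,\lhd)$ either a subset of $Q$ or an element of $\{\mathsf{Accept},\mathsf{Reject}\}$ for $q\in Q$. Put $\Sigma_q=\{a\in\Sigma\mid\delta(q,a)\neq\emptyset\}$. It is required for each $q$ that, if $\tau(q)\ne\emptyset$, then $\tau(q)$ is a finite prefix code (a set of non-empty words none of which is a proper prefix of another one), and that no word of $\tau(q)$ begins with a letter of $\Sigma_q$. **Computations.** Configurations are words $qw\cdot\lhd$ ($q\in Q$, $w\in\Sigma^*$), together with $\mathsf{Accept}$ and $\mathsf{Reject}$. The single-step relation $\vdash_A$ on $qw\cdot\lhd$ is: - if $w=uav$ with $u\in(\tau(q))^*$, $a\in\Sigma_q$, $v\in\Sigma^*$, then $qw\cdot\lhd\vdash_A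 q'uv\cdot\lhd$ for each $q'\in\delta(q,a)$; - if $w=uav$ with $u\in(\tau(q))^*$, $a\in\Sigma\setminus\Sigma_q$, $v\in\Sigma^*$ and $av\notin\tau(q)\cdot\Sigma^*$, then $qw\cdot\lhd\vdash_A\mathsf{Reject}$; - if $w\in(\tau(q))^*$, then $qw\cdot\lhd\vdash_A\mathsf{Accept}$ if $\delta(q,\lhd)=\mathsf{Accept}$; $qw\cdot\lhd\vdash_A\mathsf{Reject}$ if $\delta(q,\lhd)=\mathsf{Reject}$ or $\delta(q,\lhd)=\emptyset$; and $qw\cdot\lhd\vdash_A q'w\cdot\lhd$ for each $q'\in\delta(q,\lhd)$ if $\delta(q,\lhd)\subseteq Q$. The language accepted by $A$ is the set $L(A)$ of all $w\in\Sigma^*$ such that $q_0w\cdot\lhd\vdash_A^*\mathsf{Accept}$ for some $q_0\in I$, where $\vdash_A^*$ is the reflexive transitive closure of $\vdash_A$. An RNFAwtw is deterministic (an RDFAwtw) if $|I|=1$, $|\delta(q,a)|\le 1$ for all $q\in Q$, $a\in\Sigma$, and $|\delta(q,\lhd)|\le1$ whenever $\delta(q,\lhd)\subseteq Q$. A (non-repetitive) NFAwtw, respectively DFAwtw, is an RNFAwtw $A=(Q,\Sigma,\lhd,\tau,I,\delta)$, respectively an RDFAwtw $A=(Q,\Sigma,\lhd,\tau,I,\delta)$, such that $\delta(q,\lhd)\in\{\mathsf{Accept},\mathsf{Reject}\}$ for every state $q\in Q$. For each type $\mathsf{X}$ of automaton, $\mathcal{L}(\mathsf{X})$ is the class of all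 languages (over finite alphabets) accepted by automata of type $\mathsf{X}$. *)

theory Defs
  imports Main "HOL-Library.Sublist" "HOL-Library.Infinite_Typeclass"
begin

definition kstar :: "'a list set \<Rightarrow> 'a list set" where
  "kstar C = concat ` lists C"

definition prefix_code :: "'a list set \<Rightarrow> bool" where
  "prefix_code C \<longleftrightarrow> [] \<notin> C \<and> (\<forall>u\<in>C. \<forall>v\<in>C. \<not> strict_prefix u v)"

text \<open>
  The end-of-tape marker is not a value of the letter type. Its transitions form the separate
  component \<open>delta_end\<close>, and the marker is left implicit in configurations, so the condition
  that it does not belong to the alphabet holds by construction.
\<close>

datatype 'q end_move = End_Accept | End_Reject | End_Move "'q set"

record ('q, 'a) automaton =
  states :: "'q set"
  alphabet :: "'a set"
  transl :: "'q \<Rightarrow> 'a list set"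
  initial :: "'q set"
  delta :: "'q \<Rightarrow> 'a \<Rightarrow> 'q set"
  delta_end :: "'q \<Rightarrow> 'q end_move"

definition readable :: "('q, 'a) automaton \<Rightarrow> 'q \<Rightarrow> 'a set" where
  "readable A q = {a \<in> alphabet A. delta A q a \<noteq> {}}"

text \<open>
  The values of the components at arguments outside the state set and the alphabet are
  unconstrained; they are never used by the step relation below.
\<close>

definition RNFAwtw :: "('q, 'a) automaton \<Rightarrow> bool" where
  "RNFAwtw A \<longleftrightarrow>
     finite (states A) \<and> finite (alphabet A) \<and> initial A \<subseteq> states A \<and>
     (\<forall>q\<in>states A. \<forall>a\<in>alphabet A. delta A q a \<subseteq> states A) \<and>
     (\<forall>q\<in>states A. \<forall>P. delta_end A q = End_Move P \<longrightarrow> P \<subseteq> states A) \<and>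
     (\<forall>q\<in>states A. finite (transl A q) \<and> transl A q \<subseteq> lists (alphabet A)) \<and>
     (\<forall>q\<in>states A. transl A q \<noteq> {} \<longrightarrow> prefix_code (transl A q)) \<and>
     (\<forall>q\<in>states A. \<forall>a\<in>readable A q. \<forall>v. a # v \<notin> transl A q)"

datatype ('q, 'a) config = Conf 'q "'a list" | Accept | Reject

inductive step :: "('q, 'a) automaton \<Rightarrow> ('q, 'a) config \<Rightarrow> ('q, 'a) config \<Rightarrow> bool"
  for A :: "('q, 'a) automaton" where
  read:
    "\<lbrakk> q \<in> states A; u \<in> kstar (transl A q); a \<in> readable A q; v \<in> lists (alphabet A);
       q' \<in> delta A q a \<rbrakk>
     \<Longrightarrow> step A (Conf q (u @ a # v)) (Conf q' (u @ v))"
| stuck: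
    "\<lbrakk> q \<in> states A; u \<in> kstar (transl A q); a \<in> alphabet A - readable A q;
       v \<in> lists (alphabet A);
       \<not> (\<exists>t\<in>transl A q. \<exists>x\<in>lists (alphabet A). a # v = t @ x) \<rbrakk>
     \<Longrightarrow> step A (Conf q (u @ a # v)) Reject"
| end_accept:
    "\<lbrakk> q \<in> states A; w \<in> kstar (transl A q); delta_end A q = End_Accept \<rbrakk>
     \<Longrightarrow> step A (Conf q w) Accept"
| end_reject:
    "\<lbrakk> q \<in> states A; w \<in> kstar (transl A q);
       delta_end A q = End_Reject \<or> delta_end A q = End_Move {} \<rbrakk>
     \<Longrightarrow> step A (Conf q w) Reject"
| end_move:
    "\<lbrakk> q \<in> states A; w \<in> kstar (transl A q); delta_end A q = End_Move P; q' \<in> P \<rbrakk>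
     \<Longrightarrow> step A (Conf q w) (Conf q' w)"

definition accepted_lang :: "('q, 'a) automaton \<Rightarrow> 'a list set" where
  "accepted_lang A =
     {w \<in> lists (alphabet A). \<exists>q\<in>initial A. (step A)\<^sup>*\<^sup>* (Conf q w) Accept}"

definition RDFAwtw :: "('q, 'a) automaton \<Rightarrow> bool" where
  "RDFAwtw A \<longleftrightarrow>
     RNFAwtw A \<and> card (initial A) = 1 \<and>
     (\<forall>q\<in>states A. \<forall>a\<in>alphabet A. card (delta A q a) \<le> 1) \<and>
     (\<forall>q\<in>states A. \<forall>P. delta_end A q = End_Move P \<longrightarrow> card P \<le> 1)"

definition non_repetitive :: "('q, 'a) automaton \<Rightarrow> bool" where
  "non_repetitive A \<longleftrightarrow> (\<forall>q\<in>states A. delta_end A q \<in> {End_Accept, End_Reject})"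

definition NFAwtw :: "('q, 'a) automaton \<Rightarrow> bool" where
  "NFAwtw A \<longleftrightarrow> RNFAwtw A \<and> non_repetitive A"

definition DFAwtw :: "('q, 'a) automaton \<Rightarrow> bool" where
  "DFAwtw A \<longleftrightarrow> RDFAwtw A \<and> non_repetitive A"

text \<open>
  The state set of an automaton is finite, so up to renaming its states are natural numbers.
  The finite alphabets range over all finite sets of letters from \<open>'a\<close>, which is meant to be
  an infinite type, so that alphabets of every finite size are available.
\<close>

definition lang_class :: "((nat, 'a) automaton \<Rightarrow> bool) \<Rightarrow> 'a list set set" where
  "lang_class X = {accepted_lang A | A. X A}"

end

theory Submission
  imports Defs
begin

text \<open>
  If a non-repetitive automaton accepts a word, it also accepts the word obtained by moving the
  letters it reads to the front, in the order in which it reads them. Such a word consists of the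
  labels of a path in a finite graph, followed by translucent words of the last state. Cutting
  a bounded piece out of a long path, or one translucent word, gives a shorter accepted word, so
  the word lengths of an infinite language of this kind cannot have arbitrarily large gaps.
  A repetitive automaton, on the other hand, can turn \<open>(ab)\<^bsup>2j+2\<^esup>\<close> into \<open>(bab)\<^bsup>j+1\<^esup>\<close> and this into
  \<open>(ab)\<^bsup>j\<^esup>\<close>. Since \<open>(2j + 2) + 2 = 2(j + 2)\<close>, repeating this accepts exactly the words \<open>(ab)\<^bsup>m\<^esup>\<close>
  with \<open>m + 2\<close> a power of two greater than one.
\<close>

section \<open>Languages of non-repetitive automata have bounded gaps\<close>

lemma Nil_in_kstar [simp]: "[] \<in> kstar C"
  unfolding kstar_def by (rule image_eqI[of _ _ "[]"]) auto

lemma kstar_empty [simp]: "kstar {} = {[]}"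
  unfolding kstar_def by auto

lemma kstar_subset_lists: "C \<subseteq> lists S \<Longrightarrow> kstar C \<subseteq> lists S"
  unfolding kstar_def by fastforce

lemma kstar_singleton: "kstar {t} = range (\<lambda>n. concat (replicate n t))"
proof
  show "kstar {t} \<subseteq> range (\<lambda>n. concat (replicate n t))"
  proof
    fix w assume "w \<in> kstar {t}"
    then obtain xs where xs: "xs \<in> lists {t}" "w = concat xs"
      unfolding kstar_def by auto
    then have "xs = replicate (length xs) t"
      by (metis in_lists_conv_set replicate_eqI singletonD)
    then show "w \<in> range (\<lambda>n. concat (replicate n t))"
      using xs by (metis rangeI)
  qed
  show "range (\<lambda>n. concat (replicate n t)) \<subseteq> kstar {t}"
    unfolding kstar_def by auto
qed

text \<open>Edges carry no letters, since only word lengths matter for the gap argument.\<close>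

definition successor_rel :: "('q, 'a) automaton \<Rightarrow> ('q \<times> 'q) set" where
  "successor_rel A = {(q, q'). q \<in> states A \<and> (\<exists>a\<in>readable A q. q' \<in> delta A q a)}"

lemma finite_successor_rel:
  assumes "RNFAwtw A"
  shows "finite (successor_rel A)"
proof (rule finite_subset)
  show "successor_rel A \<subseteq> states A \<times> states A"
    using assms unfolding successor_rel_def RNFAwtw_def readable_def by blast
  show "finite (states A \<times> states A)"
    using assms unfolding RNFAwtw_def by simp
qed

text \<open>Each read consumes one letter and follows one edge. Without end moves, the marker is met
  only in the last step, when the remaining word \<open>x\<close> is translucent in
  \<open>q'\<close>.\<close>

lemma accepting_run_imp_path:
  assumes "non_repetitive A" "(step A)\<^sup>*\<^sup>* (Conf q w) Accept"
  shows "\<exists>n q' x. (q, q') \<in> successor_rel A ^^ n \<and> q' \<in> states A \<and>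
           x \<in> kstar (transl A q') \<and> delta_end A q' = End_Accept \<and> length w = n + length x"
  using assms(2)
proof (induction "Conf q w" arbitrary: q w rule: converse_rtranclp_induct)
  case (step c)
  from step.hyps(1) show ?case
  proof cases
    case (read u a v q')
    from step.hyps(3)[OF read(2)] obtain n r x where
      "(q', r) \<in> successor_rel A ^^ n" "r \<in> states A" "x \<in> kstar (transl A r)"
      "delta_end A r = End_Accept" "length (u @ v) = n + length x" by blast
    moreover have "(q, q') \<in> successor_rel A"
      using read unfolding successor_rel_def by blast
    ultimately have "(q, r) \<in> successor_rel A ^^ Suc n" "length w = Suc n + length x"
      using read by (blast intro: relpow_Suc_I2, simp)
    then show ?thesis
      using \<open>r \<in> states A\<close> \<open>x \<in> kstar (transl A r)\<close> \<open>delta_end A r = End_Accept\<close> by blast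
  next
    case end_accept
    then show ?thesis
      by (intro exI[of _ 0] exI[of _ q] exI[of _ w]) auto
  next
    case (end_move P q')
    then show ?thesis
      using assms(1) unfolding non_repetitive_def by auto
  next
    \<comment> \<open>\<open>Reject\<close> has no outgoing step, so it cannot lead to
      \<open>Accept\<close>.\<close>
    case stuck
    then show ?thesis
      using step.hyps(2) by (auto elim: converse_rtranclpE step.cases)
  next
    case end_reject
    then show ?thesis
      using step.hyps(2) by (auto elim: converse_rtranclpE step.cases)
  qed
qed

text \<open>Choosing a letter for each edge and writing these letters in path order before
  \<open>x\<close> lets every read happen at the front, with \<open>u = []\<close>.\<close>

lemma path_imp_accepting_run:
  assumes "RNFAwtw A" "(q, q') \<in> successor_rel A ^^ n" "q' \<in> states A"
    "x \<in> kstar (transl A q')" "delta_end A q' = End_Accept"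
  shows "\<exists>w\<in>lists (alphabet A). length w = n + length x \<and> (step A)\<^sup>*\<^sup>* (Conf q w) Accept"
  using assms(2)
proof (induction n arbitrary: q)
  case 0
  have "x \<in> lists (alphabet A)"
    using assms kstar_subset_lists[of "transl A q'" "alphabet A"] unfolding RNFAwtw_def by auto
  moreover have "step A (Conf q x) Accept"
    using 0 assms by (auto intro: step.end_accept)
  ultimately show ?case by auto
next
  case (Suc n)
  then obtain r where r: "(q, r) \<in> successor_rel A" "(r, q') \<in> successor_rel A ^^ n"
    by (meson relpow_Suc_D2)
  with Suc.IH obtain w where w: "w \<in> lists (alphabet A)" "length w = n + length x"
    "(step A)\<^sup>*\<^sup>* (Conf r w) Accept" by blast
  from r obtain a where a: "q \<in> states A" "a \<in> readable A q" "r \<in> delta A q a"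
    unfolding successor_rel_def by blast
  have "step A (Conf q ([] @ a # w)) (Conf r ([] @ w))"
    using a w by (intro step.read) auto
  then have "(step A)\<^sup>*\<^sup>* (Conf q (a # w)) Accept"
    using w by (simp add: converse_rtranclp_into_rtranclp)
  moreover have "a # w \<in> lists (alphabet A)"
    using a w unfolding readable_def by auto
  ultimately show ?case
    using w by (intro bexI[of _ "a # w"]) auto
qed

lemma kstar_shorten:
  assumes "x \<in> kstar C" "x \<noteq> []" "[] \<notin> C"
  obtains y t where "y \<in> kstar C" "t \<in> C" "t \<noteq> []" "x = t @ y"
proof -
  obtain ts where ts: "ts \<in> lists C" "x = concat ts"
    using assms unfolding kstar_def by auto
  with assms obtain t ts' where "ts = t # ts'" by (cases ts) auto
  with ts assms show ?thesis
    by (intro that[of "concat ts'" t]) (auto simp: kstar_def)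
qed

text \<open>The last \<open>card R + 1\<close> edges can be replaced by at most
  \<open>card R\<close> edges with the same endpoints, so the path loses at least one and at most
  \<open>card R + 1\<close> edges.\<close>

lemma relpow_shorten:
  fixes R :: "('a \<times> 'a) set"
  assumes "finite R" "(p, q) \<in> R ^^ n" "card R < n"
  obtains m where "(p, q) \<in> R ^^ m" "m < n" "n \<le> m + Suc (card R)"
proof -
  define N where "N = Suc (card R)"
  have "R ^^ n = R ^^ (n - N) O R ^^ N"
    using assms(3) unfolding N_def by (subst relpow_add [symmetric]) auto
  with assms(2) obtain r where r: "(p, r) \<in> R ^^ (n - N)" "(r, q) \<in> R ^^ N" by blast
  have "R ^^ N \<subseteq> (\<Union>k\<in>{k. k \<le> card R}. R ^^ k)"
    using relpow_finite_bounded[OF assms(1)] .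
  with r obtain k where k: "k \<le> card R" "(r, q) \<in> R ^^ k" by blast
  with r have "(p, q) \<in> R ^^ (n - N + k)"
    by (auto simp: relpow_add)
  then show ?thesis
    using k assms(3) by (intro that[of "n - N + k"]) (auto simp: N_def)
qed

lemma NFAwtw_bounded_gaps:
  assumes "NFAwtw A"
  obtains K where "\<And>w. w \<in> accepted_lang A \<Longrightarrow> K < length w \<Longrightarrow>
    \<exists>w'\<in>accepted_lang A. length w' < length w \<and> length w \<le> length w' + K"
proof -
  have A: "RNFAwtw A" "non_repetitive A"
    using assms unfolding NFAwtw_def by auto
  define R where "R = successor_rel A"
  have "finite (\<Union>q\<in>states A. transl A q)"
    using A unfolding RNFAwtw_def by auto
  then obtain B where B: "\<And>q t. q \<in> states A \<Longrightarrow> t \<in> transl A q \<Longrightarrow> length t \<le> B"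
    using finite_nat_set_iff_bounded_le[of "length ` (\<Union>q\<in>states A. transl A q)"] by auto
  show ?thesis
  proof (rule that[of "Suc (card R) + B"])
    fix w assume w: "w \<in> accepted_lang A" "Suc (card R) + B < length w"
    then obtain p where p: "p \<in> initial A" "(step A)\<^sup>*\<^sup>* (Conf p w) Accept"
      unfolding accepted_lang_def by blast
    from accepting_run_imp_path[OF A(2) p(2)] obtain n q x where
      n: "(p, q) \<in> R ^^ n" and q: "q \<in> states A" "delta_end A q = End_Accept"
      and x: "x \<in> kstar (transl A q)" and len: "length w = n + length x"
      unfolding R_def by blast
    have *: "\<exists>w'\<in>accepted_lang A. length w' = m + length y"
      if "(p, q) \<in> R ^^ m" "y \<in> kstar (transl A q)" for m y
      using path_imp_accepting_run[OF A(1), of p q m y] that p q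
      unfolding accepted_lang_def R_def by blast
    show "\<exists>w'\<in>accepted_lang A. length w' < length w \<and> length w \<le> length w' + (Suc (card R) + B)"
    proof (cases "card R < n")
      case True
      then obtain m where "(p, q) \<in> R ^^ m" "m < n" "n \<le> m + Suc (card R)"
        using relpow_shorten finite_successor_rel[OF A(1)] n unfolding R_def by metis
      moreover from this obtain w' where "w' \<in> accepted_lang A" "length w' = m + length x"
        using * x by blast
      ultimately show ?thesis
        using len by (intro bexI[of _ w']) auto
    next
      \<comment> \<open>Now the path is short, so \<open>x\<close> is non-empty and can lose its
        first translucent word, of length at most \<open>B\<close>.\<close>
      case False
      with w len have "x \<noteq> []" by auto
      moreover have "[] \<notin> transl A q"
        using A q unfolding RNFAwtw_def prefix_code_def by blast
      ultimately obtain y t where "y \<in> kstar (transl A q)" "t \<in> transl A q" "t \<noteq> []" "x = t @ y"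
        using kstar_shorten x by metis
      moreover from this obtain w' where "w' \<in> accepted_lang A" "length w' = n + length y"
        using *[OF n] by blast
      moreover have "length t \<le> B"
        using B q(1) \<open>t \<in> transl A q\<close> .
      ultimately show ?thesis
        using len by (intro bexI[of _ w']) auto
    qed
  qed
qed

section \<open>A repetitive automaton with exponential gaps\<close>

text \<open>
  State 0 checks the shape \<open>(ab)\<^bsup>m\<^esup>\<close>. A round from state 1 to state 1 turns \<open>(ab)\<^bsup>2j+2\<^esup>\<close> into \<open>(ab)\<^bsup>j\<^esup>\<close>:
  state 1 reads one \<open>a\<close>, state 2 reads the further letters \<open>a\<close> whose deletion leaves \<open>(bab)\<^bsup>j+1\<^esup>\<close>,
  states 3 and 4 remove \<open>ba\<close> from the front, and state 5 reads letters \<open>b\<close> until \<open>(ab)\<^bsup>j\<^esup>\<close> is left.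
\<close>

definition halving_automaton :: "'a \<Rightarrow> 'a \<Rightarrow> (nat, 'a) automaton" where
  "halving_automaton a b =
     \<lparr> states = {0, 1, 2, 3, 4, 5},
       alphabet = {a, b},
       transl = (\<lambda>q. if q = 0 \<or> q = 5 then {[a, b]} else if q = 2 then {[b, a, b]} else {}),
       initial = {0},
       delta = (\<lambda>q c. if c = a then (if q = 1 \<or> q = 2 then {2} else if q = 4 then {5} else {})
                      else if c = b then (if q = 3 then {4} else if q = 5 then {5} else {})
                      else {}),
       delta_end = (\<lambda>q. if q = 0 \<or> q = 5 then End_Move {1} else if q = 1 then End_Accept
                        else if q = 2 then End_Move {3} else End_Reject) \<rparr>"

lemma halving_automaton_simps [simp]:
  "states (halving_automaton a b) = {0, 1, 2, 3, 4, 5}"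
  "alphabet (halving_automaton a b) = {a, b}"
  "initial (halving_automaton a b) = {0}"
  by (simp_all add: halving_automaton_def)

lemma RDFAwtw_halving_automaton:
  assumes "a \<noteq> b"
  shows "RDFAwtw (halving_automaton a b)"
  using assms
  by (auto simp: RDFAwtw_def RNFAwtw_def halving_automaton_def readable_def prefix_code_def)

text \<open>
  A necessary condition for acceptance. In the looping states 2 and 5 it only counts the letter that
  is not read there, so that no control over the shape of the words inside a sweep is needed.
\<close>

fun halving_invariant :: "'a \<Rightarrow> 'a \<Rightarrow> (nat, 'a) config \<Rightarrow> bool" where
  "halving_invariant a b (Conf q w) \<longleftrightarrow>
     (q = 0 \<longrightarrow> w \<in> kstar {[a, b]} \<and> (\<exists>k. count_list w b + 2 = 2 ^ k)) \<and>
     (q = 1 \<or> q = 2 \<longrightarrow> (\<exists>k. count_list w b + 2 = 2 ^ k)) \<and>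
     (q = 3 \<or> q = 4 \<longrightarrow> (\<exists>k. count_list w a + 1 = 2 ^ k)) \<and>
     (q = 5 \<longrightarrow> (\<exists>k. count_list w a + 2 = 2 ^ k))"
| "halving_invariant a b Accept \<longleftrightarrow> True"
| "halving_invariant a b Reject \<longleftrightarrow> False"

lemma count_list_concat_replicate:
  "count_list (concat (replicate n w)) c = n * count_list w c"
  by (induction n) auto

lemma set_concat_replicate: "set (concat (replicate n w)) = (if n = 0 then {} else set w)"
  by (induction n) auto

text \<open>Reads in states 1, 2, 3 and 5 do not touch the counted letter; the read from 4 to 5
  removes one \<open>a\<close>, hence the shift from \<open>+ 1\<close> to \<open>+ 2\<close>. End
  moves exchange the two counts: they agree on powers of \<open>ab\<close>, and on powers of
  \<open>bab\<close> there are twice as many \<open>b\<close> as \<open>a\<close>.\<close>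

lemma halving_invariant_step:
  assumes "a \<noteq> b" "step (halving_automaton a b) c c'" "halving_invariant a b c'"
  shows "halving_invariant a b c"
  using assms(2)
proof cases
  case (read q u x v q')
  then show ?thesis
    using assms(1,3)
    by (auto simp: halving_automaton_def readable_def split: if_splits)
next
  case (stuck q u x v)
  then show ?thesis using assms(3) by simp
next
  case (end_accept q w)
  \<comment> \<open>State 1 has no translucent words, so it accepts only the empty word, where
    \<open>0 + 2 = 2 ^ 1\<close>.\<close>
  then have "q = 1" "w = []"
    by (auto simp: halving_automaton_def split: if_splits)
  then show ?thesis
    using end_accept by (auto intro: exI[of _ 1])
next
  case (end_reject q w)
  then show ?thesis using assms(3) by simp
next
  case (end_move q w P q')
  then consider "q = 0 \<or> q = 5" "q' = 1" "w \<in> kstar {[a, b]}"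
    | "q = 2" "q' = 3" "w \<in> kstar {[b, a, b]}"
    by (auto simp: halving_automaton_def split: if_splits)
  then show ?thesis
  proof cases
    case 1
    then have "count_list w a = count_list w b"
      using assms(1) by (auto simp: kstar_singleton count_list_concat_replicate)
    with 1 end_move assms(3) show ?thesis by auto
  next
    case 2
    then have "count_list w b = 2 * count_list w a"
      using assms(1) by (auto simp: kstar_singleton count_list_concat_replicate)
    moreover obtain k where "count_list w a + 1 = 2 ^ k"
      using 2 end_move assms(3) by auto
    ultimately have "count_list w b + 2 = 2 ^ Suc k" by simp
    then have "\<exists>k. count_list w b + 2 = 2 ^ k" by blast
    then show ?thesis using 2 end_move by simp
  qed
qed

lemma halving_automaton_length:
  assumes "a \<noteq> b" "w \<in> accepted_lang (halving_automaton a b)"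
  shows "\<exists>k. length w + 4 = 2 ^ k"
proof -
  have "(step (halving_automaton a b))\<^sup>*\<^sup>* (Conf 0 w) Accept"
    using assms(2) unfolding accepted_lang_def by simp
  then have "halving_invariant a b (Conf 0 w)"
    by (induction rule: converse_rtranclp_induct)
      (auto simp del: halving_invariant.simps(1) intro: halving_invariant_step[OF assms(1)])
  then obtain k where k: "w \<in> kstar {[a, b]}" "count_list w b + 2 = 2 ^ k" by auto
  then have "length w = 2 * count_list w b"
    using assms(1)
    by (auto simp: kstar_singleton count_list_concat_replicate length_concat sum_list_replicate)
  with k have "length w + 4 = 2 ^ Suc k" by simp
  then show ?thesis by blast
qed

section \<open>Accepting runs of the halving automaton\<close>

lemma concat_replicate_append:
  "concat (replicate n w) @ w @ x = concat (replicate (Suc n) w) @ x"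
  by (induction n) auto

text \<open>The block of words \<open>bab\<close> is skipped; deleting the first \<open>a\<close> of
  the next \<open>abab\<close> extends that block by one.\<close>

lemma halving_automaton_phase2:
  assumes "a \<noteq> b"
  shows "(step (halving_automaton a b))\<^sup>*\<^sup>*
    (Conf 2 (concat (replicate i [b, a, b]) @ concat (replicate j [a, b, a, b])))
    (Conf 2 (concat (replicate (i + j) [b, a, b])))"
proof (induction j arbitrary: i)
  case (Suc j)
  have "step (halving_automaton a b)
    (Conf 2 (concat (replicate i [b, a, b]) @ a # [b, a, b] @ concat (replicate j [a, b, a, b])))
    (Conf 2 (concat (replicate i [b, a, b]) @ [b, a, b] @ concat (replicate j [a, b, a, b])))"
    using assms
    by (intro step.read)
      (auto simp: halving_automaton_def readable_def kstar_singleton set_concat_replicate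
        simp del: set_concat split: if_splits)
  then show ?case
    using Suc[of "Suc i"]
    unfolding concat_replicate_append by (simp add: converse_rtranclp_into_rtranclp)
qed simp

lemma halving_automaton_phase5:
  assumes "a \<noteq> b"
  shows "(step (halving_automaton a b))\<^sup>*\<^sup>*
    (Conf 5 (concat (replicate i [a, b]) @ concat (replicate j [b, a, b])))
    (Conf 5 (concat (replicate (i + j) [a, b])))"
proof (induction j arbitrary: i)
  case (Suc j)
  have "step (halving_automaton a b)
    (Conf 5 (concat (replicate i [a, b]) @ b # [a, b] @ concat (replicate j [b, a, b])))
    (Conf 5 (concat (replicate i [a, b]) @ [a, b] @ concat (replicate j [b, a, b])))"
    using assms
    by (intro step.read)
      (auto simp: halving_automaton_def readable_def kstar_singleton set_concat_replicate
        simp del: set_concat split: if_splits)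
  then show ?case
    using Suc[of "Suc i"]
    unfolding concat_replicate_append by (simp add: converse_rtranclp_into_rtranclp)
qed simp

lemma halving_automaton_round:
  assumes "a \<noteq> b"
  shows "(step (halving_automaton a b))\<^sup>*\<^sup>*
    (Conf 1 (concat (replicate (2 * j + 2) [a, b]))) (Conf 1 (concat (replicate j [a, b])))"
proof -
  let ?S = "step (halving_automaton a b)"
  let ?w = "concat (replicate j [a, b, a, b])" and ?v = "concat (replicate j [b, a, b])"
  \<comment> \<open>The first \<open>a\<close> falls to state 1, which leaves one \<open>bab\<close>
    followed by \<open>j\<close> blocks \<open>abab\<close> for state 2.\<close>
  have "concat (replicate (2 * j + 2) [a, b]) = a # [b, a, b] @ ?w"
    by (induction j) auto
  moreover have "?S (Conf 1 ([] @ a # [b, a, b] @ ?w)) (Conf 2 ([] @ [b, a, b] @ ?w))"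
    using assms
    by (intro step.read)
      (auto simp: halving_automaton_def readable_def set_concat_replicate
        simp del: set_concat split: if_splits)
  ultimately have "?S\<^sup>*\<^sup>* (Conf 1 (concat (replicate (2 * j + 2) [a, b]))) (Conf 2 ([b, a, b] @ ?w))"
    by auto
  also have "?S\<^sup>*\<^sup>* (Conf 2 ([b, a, b] @ ?w)) (Conf 2 ([b, a, b] @ ?v))"
    using halving_automaton_phase2[OF assms, of 1 j] by simp
  also have "?S (Conf 2 ([b, a, b] @ ?v)) (Conf 3 ([b, a, b] @ ?v))"
  proof (rule step.end_move)
    have "[b, a, b] @ ?v = concat (replicate (Suc j) [b, a, b])" by simp
    then show "[b, a, b] @ ?v \<in> kstar (transl (halving_automaton a b) 2)"
      unfolding halving_automaton_def by (simp add: kstar_singleton del: replicate_Suc)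
  qed (auto simp: halving_automaton_def)
  also have "?S (Conf 3 ([] @ b # [a, b] @ ?v)) (Conf 4 ([] @ [a, b] @ ?v))"
    using assms
    by (intro step.read)
      (auto simp: halving_automaton_def readable_def set_concat_replicate
        simp del: set_concat split: if_splits)
  then have "?S (Conf 3 ([b, a, b] @ ?v)) (Conf 4 ([a, b] @ ?v))" by simp
  also have "?S (Conf 4 ([] @ a # [b] @ ?v)) (Conf 5 ([] @ [b] @ ?v))"
    using assms
    by (intro step.read)
      (auto simp: halving_automaton_def readable_def set_concat_replicate
        simp del: set_concat split: if_splits)
  then have "?S (Conf 4 ([a, b] @ ?v)) (Conf 5 (b # ?v))" by simp
  \<comment> \<open>This \<open>b\<close> is the rest of the first \<open>bab\<close>, whose
    \<open>ba\<close> states 3 and 4 have read.\<close>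
  also have "?S (Conf 5 ([] @ b # ?v)) (Conf 5 ([] @ ?v))"
    using assms
    by (intro step.read)
      (auto simp: halving_automaton_def readable_def set_concat_replicate
        simp del: set_concat split: if_splits)
  then have "?S (Conf 5 (b # ?v)) (Conf 5 ?v)" by simp
  also have "?S\<^sup>*\<^sup>* (Conf 5 ?v) (Conf 5 (concat (replicate j [a, b])))"
    using halving_automaton_phase5[OF assms, of 0 j] by simp
  also have "?S (Conf 5 (concat (replicate j [a, b]))) (Conf 1 (concat (replicate j [a, b])))"
    by (rule step.end_move) (auto simp: halving_automaton_def kstar_singleton)
  finally show ?thesis .
qed

lemma halving_automaton_accepts:
  assumes "a \<noteq> b"
  shows "concat (replicate (2 ^ Suc k - 2) [a, b]) \<in> accepted_lang (halving_automaton a b)"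
proof -
  let ?S = "step (halving_automaton a b)" and ?w = "\<lambda>m. concat (replicate m [a, b])"
  have "?S\<^sup>*\<^sup>* (Conf 1 (?w (2 ^ Suc k - 2))) Accept"
  proof (induction k)
    case 0
    have "?S (Conf 1 []) Accept"
      by (rule step.end_accept) (auto simp: halving_automaton_def)
    then show ?case by auto
  next
    case (Suc k)
    \<comment> \<open>The exponents obey the recursion of a round; \<open>2 ^ Suc k\<close> is at
      least 2, so subtraction does not truncate.\<close>
    have "2 ^ Suc (Suc k) - 2 = 2 * (2 ^ Suc k - 2) + (2 :: nat)"
      using one_le_power[of "2 :: nat" k] unfolding power_Suc by linarith
    then show ?case
      using halving_automaton_round[OF assms, of "2 ^ Suc k - 2"] Suc by (metis rtranclp_trans)
  qed
  moreover have "?S (Conf 0 (?w m)) (Conf 1 (?w m))" for m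
    by (rule step.end_move) (auto simp: halving_automaton_def kstar_singleton)
  ultimately show ?thesis
    unfolding accepted_lang_def
    by (auto simp: set_concat_replicate simp del: set_concat split: if_splits
        intro: converse_rtranclp_into_rtranclp)
qed

section \<open>Separation of the language classes\<close>

lemma halving_language_not_NFAwtw:
  assumes "a \<noteq> b" "NFAwtw A"
  shows "accepted_lang A \<noteq> accepted_lang (halving_automaton a b)"
proof
  assume eq: "accepted_lang A = accepted_lang (halving_automaton a b)"
  from NFAwtw_bounded_gaps[OF assms(2)] obtain K where
    K: "\<And>w. w \<in> accepted_lang A \<Longrightarrow> K < length w \<Longrightarrow>
      \<exists>w'\<in>accepted_lang A. length w' < length w \<and> length w \<le> length w' + K" by blast
  \<comment> \<open>The lengths plus 4 are powers of two. Below \<open>2 ^ (k + 2)\<close> the next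
    candidate is \<open>2 ^ (k + 1)\<close>, and this choice of \<open>k\<close> makes their
    difference exceed \<open>K\<close>.\<close>
  define k where "k = K + 3"
  define w where "w = concat (replicate (2 ^ Suc k - 2) [a, b])"
  have "K < 2 ^ K" by (rule less_exp)
  then have "2 * K + 4 < 8 * 2 ^ K" by linarith
  then have k: "2 * K + 4 < 2 ^ k"
    unfolding k_def by (simp add: power_add mult.commute)
  have len: "length w + 4 = 2 * 2 ^ Suc k"
    using k unfolding w_def by (simp add: length_concat sum_list_replicate)
  moreover have "w \<in> accepted_lang A"
    using halving_automaton_accepts[OF assms(1)] unfolding eq w_def .
  ultimately obtain w' where w': "w' \<in> accepted_lang A" "length w' < length w"
    "length w \<le> length w' + K"
    using K[of w] k by auto
  then obtain j where j: "length w' + 4 = 2 ^ j"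
    using halving_automaton_length[OF assms(1)] eq by blast
  with w' len have "(2::nat) ^ j < 2 ^ Suc (Suc k)" by simp
  then have "j \<le> Suc k"
    by (simp only: power_strict_increasing_iff less_Suc_eq_le)
  then have "(2::nat) ^ j \<le> 2 ^ Suc k"
    by (intro power_increasing) auto
  with j len w' k show False by simp
qed

theorem corollary17:
  shows "(lang_class DFAwtw :: 'a::infinite list set set) \<subset> lang_class RDFAwtw
       \<and> (lang_class NFAwtw :: 'a list set set) \<subset> lang_class RNFAwtw"
proof -
  obtain a :: 'a where True by simp
  obtain b where "b \<noteq> a"
    using ex_new_if_finite[OF infinite_UNIV, of "{a}"] by auto
  then have ab: "a \<noteq> b" by simp
  \<comment> \<open>One language separates both pairs: its automaton is deterministic, yet no
    non-repetitive automaton accepts it, even a nondeterministic one.\<close>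
  let ?L = "accepted_lang (halving_automaton a b)"
  have RDFA: "?L \<in> lang_class RDFAwtw"
    using RDFAwtw_halving_automaton[OF ab] unfolding lang_class_def by blast
  then have RNFA: "?L \<in> lang_class RNFAwtw"
    unfolding lang_class_def RDFAwtw_def by blast
  have NFA: "?L \<notin> lang_class NFAwtw"
    using halving_language_not_NFAwtw[OF ab] unfolding lang_class_def by blast
  then have DFA: "?L \<notin> lang_class DFAwtw"
    unfolding lang_class_def DFAwtw_def RDFAwtw_def NFAwtw_def by blast
  have "(lang_class DFAwtw :: 'a list set set) \<subseteq> lang_class RDFAwtw"
    "(lang_class NFAwtw :: 'a list set set) \<subseteq> lang_class RNFAwtw"
    unfolding lang_class_def DFAwtw_def NFAwtw_def by blast+
  with RDFA RNFA NFA DFA show ?thesis by blast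
qed

end
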